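(* A family of process-based dynamic risk measures $\{\rho^\pi_{t,T}\}_{t=1,\dots,T}^{\pi\in\Pi}$ is translation-invariant and stochastically conditionally time-consistent if and only if there exist functionals $$\sigma_t:\Big\{\bigcup_{\pi\in\Pi}\operatorname{graph}(Q^\pi_t)\Big\}\times\mathcal{V}\to\mathbb{R},\quad t=1,\dots,T-1,$$ such that: (i) for all $t=1,\dots,T-1$ and all $h_t\in\mathcal{X}^t$, $\sigma_t(h_t,\cdot,\cdot)$ is normalized and has the following property of strong monotonicity with respect to stochastic dominance: for all $q^1,q^2\in\{Q^\pi_t(h_t):\pi\in\Pi\}$ and all $v^1,v^2\in\mathcal{V}$, $$(v^1;q^1)\preceq_{\mathrm{st}}(v^2;q^2)\implies\sigma_t(h_t,q^1,v^1)\le\sigma_t(h_t,q^2,v^2),$$ where $(v;q)=q\circ v^{-1}$ is the distribution of $v$ under $q$; (ii) for all $\pi\in\Pi$, all $t=1,\dots,T-1$, all $(Z_t,\dots,Z_T)\in\mathcal{Z}_{t,T}$, and all $h_t\in\mathcal{X}^t$, $$\rho^\pi_{t,T}(Z_t,\dots,Z_T)(h_t)=Z_t(h_t)+\sigma_t\big(h_t,Q^\pi_t(h_t),\rho^\pi_{t+1,T}(Z_{t+1},\dots,Z_T)(h_t,\cdot)\big).$$ Moreover, for all $t=1,\dots,T-1$, $\sigma_t$ is uniquely determined by $\{\rho^\pi_{t,T}\}_{\pi\in\Pi}$ as follows: for every $h_t\in\mathcal{X}^t$, every $q\in\{Q^\pi_t(h_t):\pi\in\Pi\}$, and every $v\in\mathcal{V}$,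 $$\sigma_t(h_t,q,v)=\rho^\pi_{t,T}(0,V,0,\dots,0)(h_t),$$ where $\pi$ is any admissible policy such that $q=Q^\pi_t(h_t)$, and $V\in\mathcal{Z}_{t+1}$ satisfies $V(h_t,\cdot)=v(\cdot)$ and can be arbitrary elsewhere.
   Context: Setting. $\mathcal{X}$ is a Polish space with Borel $\sigma$-algebra, $T$ is a natural number, $X_1,\dots,X_T$ are the canonical projections on $\mathcal{X}^T$ (with product $\sigma$-algebra), $\mathcal{F}_t=\sigma(X_1,\dots,X_t)$, and $h_t=(x_1,\dots,x_t)\in\mathcal{X}^t$ denotes a history. $\mathcal{P}(\mathcal{X})$ is the set of probability measures on $\mathcal{X}$; $\mathcal{V}$ is the set of bounded measurable functions $\mathcal{X}\to\mathbb{R}$. $\mathcal{Z}_t$ is the set of bounded $\mathcal{F}_t$-measurable functions $\mathcal{X}^T\to\mathbb{R}$, identified with bounded measurable functions of $h_t\in\mathcal{X}^t$; $\mathcal{Z}_{t,T}=\mathcal{Z}_t\times\dots\times\mathcal{Z}_T$. Relations between random variables are understood everywhere. Controls and policies. $\mathcal{U}$ is a Borel control space. Let $\mathcal{G}_1=\mathcal{X}$ and $\mathcal{G}_{t+1}=\operatorname{graph}(\mathcal{U}_t)\times\mathcal{X}\subseteq(\mathcal{X}\times\mathcal{U})^t\times\mathcal{X}$, $t=1,\dots,T-1$, where $\mathcal{U}_t:\mathcal{G}_t\rightrightarrows\mathcal{U}$, $t=1,\dots,T$, are measurable multifunctions (admissible control sets). Transition kernels $Q_t:\operatorname{graph}(\mathcal{U}_t)\to\mathcal{P}(\mathcal{X})$,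 $t=1,\dots,T-1$, are measurable; $Q_t(x_1,u_1,\dots,x_t,u_t)$ is the conditional distribution of $X_{t+1}$. An admissible policy is a sequence $\pi=(\pi_1,\dots,\pi_T)$ of measurable functions $\pi_t:\mathcal{X}^t\to\mathcal{U}$ with $\pi_t(x_1,\dots,x_t)\in\mathcal{U}_t(x_1,\pi_1(x_1),\dots,x_{t-1},\pi_{t-1}(x_1,\dots,x_{t-1}),x_t)$ for all $t$ and all $(x_1,\dots,x_t)$; $\Pi$ is the set of admissible policies. For $\pi\in\Pi$, $Q^\pi_t:\mathcal{X}^t\to\mathcal{P}(\mathcal{X})$ is $Q^\pi_t(x_1,\dots,x_t)=Q_t(x_1,\pi_1(x_1),\dots,x_t,\pi_t(x_1,\dots,x_t))$, and $\operatorname{graph}(Q^\pi_t)=\{(h_t,Q^\pi_t(h_t)):h_t\in\mathcal{X}^t\}$. Dynamic risk measures. A conditional risk measure is a mapping $\rho_{t,T}:\mathcal{Z}_{t,T}\to\mathcal{Z}_t$ that is monotone: $Z_s\le W_s$ for $s=t,\dots,T$ implies $\rho_{t,T}(Z_t,\dots,Z_T)\le\rho_{t,T}(W_t,\dots,W_T)$. All conditional risk measures are assumed normalized: $\rho_{t,T}(0,\dots,0)=0$. It is translation-invariant if $\rho_{t,T}(Z_t,\dots,Z_T)=Z_t+\rho_{t,T}(0,Z_{t+1},\dots,Z_T)$ always. A (process-based) dynamic risk measure is a sequence $\{\rho_{t,T}\}_{t=1,\dots,T}$ of conditional risk measures. A family $\{\rho^\pi_{t,T}\}_{t=1,\dots,T}^{\pi\in\Pi}$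 consists of one dynamic risk measure for each $\pi\in\Pi$; it is translation-invariant if each $\rho^\pi_{t,T}$, $t=1,\dots,T$, is. Stochastic conditional time consistency. The family is stochastically conditionally time-consistent if for any $\pi,\pi'\in\Pi$, any $1\le t<T$, all $h_t\in\mathcal{X}^t$, and all $(Z_t,\dots,Z_T),(W_t,\dots,W_T)\in\mathcal{Z}_{t,T}$, the conditions $Z_t(h_t)=W_t(h_t)$ and $$Q^\pi_t(h_t)\big(\{x:\rho^\pi_{t+1,T}(Z_{t+1},\dots,Z_T)(h_t,x)>\eta\}\big)\le Q^{\pi'}_t(h_t)\big(\{x:\rho^{\pi'}_{t+1,T}(W_{t+1},\dots,W_T)(h_t,x)>\eta\}\big)\quad\forall\eta\in\mathbb{R}$$ imply $\rho^\pi_{t,T}(Z_t,\dots,Z_T)(h_t)\le\rho^{\pi'}_{t,T}(W_t,\dots,W_T)(h_t)$. Other notation. For probability measures $\mu,\nu$ on $\mathbb{R}$, $\mu\preceq_{\mathrm{st}}\nu$ means $\mu((\eta,\infty))\le\nu((\eta,\infty))$ for all $\eta\in\mathbb{R}$. "$\sigma_t(h_t,\cdot,\cdot)$ is normalized" means $\sigma_t(h_t,q,0)=0$ for all $q\in\{Q^\pi_t(h_t):\pi\in\Pi\}$.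
   Formalization: The right side of the equivalence also requires ρ_{T,T}(Z_T) = Z_T for every policy: (i) and (ii) do not constrain time T, so without it the "if" direction fails, e.g. for ρ_{T,T}(Z_T) = 2 Z_T continued backwards by conditional expectations. *)

theory Defs
  imports "HOL-Probability.Probability"
begin

text \<open>
  A history \<open>h\<^sub>t = (x\<^sub>1, \<dots>, x\<^sub>t)\<close> is a function on \<open>{1..t}\<close> that is \<open>undefined\<close> elsewhere, and
  \<open>(h\<^sub>t, x)\<close> is \<open>h(Suc t := x)\<close>.
\<close>

definition hist :: "nat \<Rightarrow> (nat \<Rightarrow> 'x::polish_space) measure" where
  "hist t = (\<Pi>\<^sub>M s\<in>{1..t}. borel)"

text \<open>
  The Borel control space is a Borel subset \<open>U\<close> of a Polish space. A controlled history
  \<open>(x\<^sub>1, u\<^sub>1, \<dots>, x\<^sub>t, u\<^sub>t)\<close> is a function on \<open>{1..t}\<close> with values in \<open>\<X> \<times> U\<close>.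
\<close>

definition ctrl_hist :: "'u::polish_space set \<Rightarrow> nat \<Rightarrow> (nat \<Rightarrow> 'x::polish_space \<times> 'u) measure" where
  "ctrl_hist U t = (\<Pi>\<^sub>M s\<in>{1..t}. borel \<Otimes>\<^sub>M restrict_space borel U)"

text \<open>
  \<open>adm_graph A t\<close> is the graph of \<open>A t\<close>, viewed as a subset of \<open>(\<X> \<times> U)\<^sup>t\<close>. For \<open>t = 0\<close> it consists
  of the empty sequence only, so that \<open>adm_dom A 1\<close> is a copy of \<open>\<X>\<close>.
\<close>

primrec adm_graph :: "(nat \<Rightarrow> (nat \<Rightarrow> 'x \<times> 'u) \<times> 'x \<Rightarrow> 'u set) \<Rightarrow> nat \<Rightarrow> (nat \<Rightarrow> 'x \<times> 'u) set" where
  "adm_graph A 0 = {\<lambda>_. undefined}"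
| "adm_graph A (Suc t) =
     {w(Suc t := (x, u)) | w x u. w \<in> adm_graph A t \<and> u \<in> A (Suc t) (w, x)}"

definition adm_dom ::
    "(nat \<Rightarrow> (nat \<Rightarrow> 'x \<times> 'u) \<times> 'x \<Rightarrow> 'u set) \<Rightarrow> nat \<Rightarrow> ((nat \<Rightarrow> 'x \<times> 'u) \<times> 'x) set" where
  "adm_dom A t = adm_graph A (t - 1) \<times> UNIV"

text \<open>Measurability of a multifunction: the inverse image of every open set is measurable.\<close>

definition measurable_multifunction :: "'g measure \<Rightarrow> 'u::topological_space set \<Rightarrow> ('g \<Rightarrow> 'u set) \<Rightarrow> bool" where
  "measurable_multifunction M U F \<longleftrightarrow>
     (\<forall>g\<in>space M. F g \<subseteq> U) \<and>
     (\<forall>S. open S \<longrightarrow> {g \<in> space M. F g \<inter> S \<noteq> {}} \<in> sets M)"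

locale controlled_system =
  fixes T :: nat
    and U :: "'u::polish_space set"
    and A :: "nat \<Rightarrow> (nat \<Rightarrow> 'x::polish_space \<times> 'u) \<times> 'x \<Rightarrow> 'u set"
    and Q :: "nat \<Rightarrow> (nat \<Rightarrow> 'x \<times> 'u) \<Rightarrow> 'x measure"
  assumes horizon: "1 \<le> T"
    and control_space: "U \<in> sets borel"
    and admissible_controls: "\<And>t. t \<in> {1..T} \<Longrightarrow>
      measurable_multifunction
        (restrict_space (ctrl_hist U (t - 1) \<Otimes>\<^sub>M borel) (adm_dom A t)) U (A t)"
    and kernels: "\<And>t. t \<in> {1..<T} \<Longrightarrow>
      Q t \<in> restrict_space (ctrl_hist U t) (adm_graph A t) \<rightarrow>\<^sub>M prob_algebra borel"

definition traj ::
    "(nat \<Rightarrow> (nat \<Rightarrow> 'x) \<Rightarrow> 'u) \<Rightarrow> nat \<Rightarrow> (nat \<Rightarrow> 'x) \<Rightarrow> (nat \<Rightarrow> 'x \<times> 'u)" where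
  "traj \<pi> t h = (\<lambda>s\<in>{1..t}. (h s, \<pi> s (restrict h {1..s})))"

text \<open>
  Policies are \<open>undefined\<close> outside their domains, so that equality of policies is equality of the
  functions \<open>\<pi>\<^sub>t : \<X>\<^sup>t \<rightarrow> U\<close> for \<open>t = 1, \<dots>, T\<close>.
\<close>

definition policies ::
    "nat \<Rightarrow> 'u::polish_space set \<Rightarrow> (nat \<Rightarrow> (nat \<Rightarrow> 'x::polish_space \<times> 'u) \<times> 'x \<Rightarrow> 'u set)
      \<Rightarrow> (nat \<Rightarrow> (nat \<Rightarrow> 'x) \<Rightarrow> 'u) set" where
  "policies T U A = {\<pi> \<in> extensional {1..T}. \<forall>t\<in>{1..T}.
     \<pi> t \<in> extensional (space (hist t)) \<and>
     \<pi> t \<in> hist t \<rightarrow>\<^sub>M restrict_space borel U \<and>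
     (\<forall>h\<in>space (hist t). \<pi> t h \<in> A t (traj \<pi> (t - 1) h, h t))}"

definition Q_pol ::
    "(nat \<Rightarrow> (nat \<Rightarrow> 'x \<times> 'u) \<Rightarrow> 'x measure) \<Rightarrow> (nat \<Rightarrow> (nat \<Rightarrow> 'x) \<Rightarrow> 'u)
      \<Rightarrow> nat \<Rightarrow> (nat \<Rightarrow> 'x) \<Rightarrow> 'x measure" where
  "Q_pol Q \<pi> t h = Q t (traj \<pi> t h)"

definition bdd_fun :: "('x::polish_space \<Rightarrow> real) set" where
  "bdd_fun = {v \<in> borel_measurable borel. bounded (range v)}"

text \<open>
  \<open>\<Z>\<^sub>t\<close> is taken in its identified form, as functions of \<open>h\<^sub>t \<in> \<X>\<^sup>t\<close>, \<open>undefined\<close> outside \<open>\<X>\<^sup>t\<close>.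
  A tuple \<open>(Z\<^sub>t, \<dots>, Z\<^sub>T)\<close> is a function on \<open>{t..T}\<close>, and its tail \<open>(Z\<^bsub>t+1\<^esub>, \<dots>, Z\<^sub>T)\<close> is the
  restriction to \<open>{Suc t..T}\<close>.
\<close>

definition Zsp :: "nat \<Rightarrow> ((nat \<Rightarrow> 'x::polish_space) \<Rightarrow> real) set" where
  "Zsp t = {Z \<in> extensional (space (hist t)). Z \<in> borel_measurable (hist t) \<and>
              bounded (Z ` space (hist t))}"

definition Ztup :: "nat \<Rightarrow> nat \<Rightarrow> (nat \<Rightarrow> (nat \<Rightarrow> 'x::polish_space) \<Rightarrow> real) set" where
  "Ztup T t = (\<Pi>\<^sub>E s\<in>{t..T}. Zsp s)"

definition zero_rv :: "nat \<Rightarrow> (nat \<Rightarrow> 'x::polish_space) \<Rightarrow> real" where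
  "zero_rv t = (\<lambda>h\<in>space (hist t). 0)"

definition zero_tup :: "nat \<Rightarrow> nat \<Rightarrow> nat \<Rightarrow> (nat \<Rightarrow> 'x::polish_space) \<Rightarrow> real" where
  "zero_tup T t = (\<lambda>s\<in>{t..T}. zero_rv s)"

definition conditional_risk_measure ::
    "nat \<Rightarrow> nat \<Rightarrow> ((nat \<Rightarrow> (nat \<Rightarrow> 'x::polish_space) \<Rightarrow> real) \<Rightarrow> (nat \<Rightarrow> 'x) \<Rightarrow> real) \<Rightarrow> bool" where
  "conditional_risk_measure T t r \<longleftrightarrow>
     r \<in> Ztup T t \<rightarrow> Zsp t \<and>
     (\<forall>Z\<in>Ztup T t. \<forall>W\<in>Ztup T t.
        (\<forall>s\<in>{t..T}. \<forall>h\<in>space (hist s). Z s h \<le> W s h) \<longrightarrow>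
        (\<forall>h\<in>space (hist t). r Z h \<le> r W h)) \<and>
     r (zero_tup T t) = zero_rv t"

definition translation_invariant ::
    "nat \<Rightarrow> nat \<Rightarrow> ((nat \<Rightarrow> (nat \<Rightarrow> 'x::polish_space) \<Rightarrow> real) \<Rightarrow> (nat \<Rightarrow> 'x) \<Rightarrow> real) \<Rightarrow> bool" where
  "translation_invariant T t r \<longleftrightarrow>
     (\<forall>Z\<in>Ztup T t. \<forall>h\<in>space (hist t). r Z h = Z t h + r (Z(t := zero_rv t)) h)"

type_synonym ('x, 'u) risk_family =
  "(nat \<Rightarrow> (nat \<Rightarrow> 'x) \<Rightarrow> 'u) \<Rightarrow> nat \<Rightarrow>
     (nat \<Rightarrow> (nat \<Rightarrow> 'x) \<Rightarrow> real) \<Rightarrow> (nat \<Rightarrow> 'x) \<Rightarrow> real"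

definition dynamic_risk_family ::
    "nat \<Rightarrow> (nat \<Rightarrow> (nat \<Rightarrow> 'x) \<Rightarrow> 'u) set \<Rightarrow> ('x::polish_space, 'u) risk_family \<Rightarrow> bool" where
  "dynamic_risk_family T P \<rho> \<longleftrightarrow>
     (\<forall>\<pi>\<in>P. \<forall>t\<in>{1..T}. conditional_risk_measure T t (\<rho> \<pi> t))"

definition translation_invariant_family ::
    "nat \<Rightarrow> (nat \<Rightarrow> (nat \<Rightarrow> 'x) \<Rightarrow> 'u) set \<Rightarrow> ('x::polish_space, 'u) risk_family \<Rightarrow> bool" where
  "translation_invariant_family T P \<rho> \<longleftrightarrow>
     (\<forall>\<pi>\<in>P. \<forall>t\<in>{1..T}. translation_invariant T t (\<rho> \<pi> t))"

definition next_section ::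
    "nat \<Rightarrow> ('x::polish_space, 'u) risk_family \<Rightarrow> (nat \<Rightarrow> (nat \<Rightarrow> 'x) \<Rightarrow> 'u) \<Rightarrow> nat
      \<Rightarrow> (nat \<Rightarrow> (nat \<Rightarrow> 'x) \<Rightarrow> real) \<Rightarrow> (nat \<Rightarrow> 'x) \<Rightarrow> 'x \<Rightarrow> real" where
  "next_section T \<rho> \<pi> t Z h x = \<rho> \<pi> (Suc t) (restrict Z {Suc t..T}) (h(Suc t := x))"

definition stoch_cond_time_consistent ::
    "nat \<Rightarrow> (nat \<Rightarrow> (nat \<Rightarrow> 'x) \<Rightarrow> 'u) set \<Rightarrow> (nat \<Rightarrow> (nat \<Rightarrow> 'x \<times> 'u) \<Rightarrow> 'x measure)
      \<Rightarrow> ('x::polish_space, 'u) risk_family \<Rightarrow> bool" where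
  "stoch_cond_time_consistent T P Q \<rho> \<longleftrightarrow>
     (\<forall>\<pi>\<in>P. \<forall>\<pi>'\<in>P. \<forall>t\<in>{1..<T}. \<forall>h\<in>space (hist t). \<forall>Z\<in>Ztup T t. \<forall>W\<in>Ztup T t.
        Z t h = W t h \<longrightarrow>
        (\<forall>\<eta>. measure (Q_pol Q \<pi> t h) {x. next_section T \<rho> \<pi> t Z h x > \<eta>}
            \<le> measure (Q_pol Q \<pi>' t h) {x. next_section T \<rho> \<pi>' t W h x > \<eta>}) \<longrightarrow>
        \<rho> \<pi> t Z h \<le> \<rho> \<pi>' t W h)"

definition st_le :: "real measure \<Rightarrow> real measure \<Rightarrow> bool"  (infix "\<preceq>\<^sub>s\<^sub>t" 50) where
  "\<mu> \<preceq>\<^sub>s\<^sub>t \<nu> \<longleftrightarrow> (\<forall>\<eta>. measure \<mu> {\<eta><..} \<le> measure \<nu> {\<eta><..})"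

text \<open>
  The functionals \<open>\<sigma>\<^sub>t\<close> are total in HOL; only their values at \<open>(h, q, v)\<close> with
  \<open>q \<in> attainable P Q t h\<close>, that is \<open>(h, q)\<close> in the union of the graphs, and \<open>v \<in> bdd_fun\<close> matter.
\<close>

definition attainable ::
    "(nat \<Rightarrow> (nat \<Rightarrow> 'x) \<Rightarrow> 'u) set \<Rightarrow> (nat \<Rightarrow> (nat \<Rightarrow> 'x \<times> 'u) \<Rightarrow> 'x measure)
      \<Rightarrow> nat \<Rightarrow> (nat \<Rightarrow> 'x) \<Rightarrow> 'x measure set" where
  "attainable P Q t h = (\<lambda>\<pi>. Q_pol Q \<pi> t h) ` P"

definition normalized_functional :: "'x measure set \<Rightarrow> ('x measure \<Rightarrow> ('x \<Rightarrow> real) \<Rightarrow> real) \<Rightarrow> bool" where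
  "normalized_functional K s \<longleftrightarrow> (\<forall>q\<in>K. s q (\<lambda>_. 0) = 0)"

definition strongly_monotone ::
    "'x::polish_space measure set \<Rightarrow> ('x measure \<Rightarrow> ('x \<Rightarrow> real) \<Rightarrow> real) \<Rightarrow> bool" where
  "strongly_monotone K s \<longleftrightarrow>
     (\<forall>q1\<in>K. \<forall>q2\<in>K. \<forall>v1\<in>bdd_fun. \<forall>v2\<in>bdd_fun.
        distr q1 borel v1 \<preceq>\<^sub>s\<^sub>t distr q2 borel v2 \<longrightarrow> s q1 v1 \<le> s q2 v2)"

definition represents ::
    "nat \<Rightarrow> (nat \<Rightarrow> (nat \<Rightarrow> 'x) \<Rightarrow> 'u) set \<Rightarrow> (nat \<Rightarrow> (nat \<Rightarrow> 'x \<times> 'u) \<Rightarrow> 'x measure)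
      \<Rightarrow> ('x::polish_space, 'u) risk_family
      \<Rightarrow> (nat \<Rightarrow> (nat \<Rightarrow> 'x) \<Rightarrow> 'x measure \<Rightarrow> ('x \<Rightarrow> real) \<Rightarrow> real) \<Rightarrow> bool" where
  "represents T P Q \<rho> \<sigma> \<longleftrightarrow>
     (\<forall>t\<in>{1..<T}. \<forall>h\<in>space (hist t).
        normalized_functional (attainable P Q t h) (\<sigma> t h) \<and>
        strongly_monotone (attainable P Q t h) (\<sigma> t h)) \<and>
     (\<forall>\<pi>\<in>P. \<forall>t\<in>{1..<T}. \<forall>Z\<in>Ztup T t. \<forall>h\<in>space (hist t).
        \<rho> \<pi> t Z h = Z t h + \<sigma> t h (Q_pol Q \<pi> t h) (next_section T \<rho> \<pi> t Z h))"

text \<open>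
  The recursion satisfied by a representing \<open>\<sigma>\<close> stops at \<open>T - 1\<close> and leaves \<open>\<rho>\<^bsub>T,T\<^esub>\<close> unconstrained,
  whereas translation invariance at \<open>T\<close> together with normalization says \<open>\<rho>\<^bsub>T,T\<^esub>(Z\<^sub>T) = Z\<^sub>T\<close>.
  This terminal condition therefore has to accompany the recursion; without it,
  \<open>\<rho>\<^bsub>T,T\<^esub>(Z\<^sub>T) = 2 Z\<^sub>T\<close> continued backwards by conditional expectations would satisfy
  the recursion and not be translation-invariant.
\<close>

definition terminal_condition ::
    "nat \<Rightarrow> (nat \<Rightarrow> (nat \<Rightarrow> 'x) \<Rightarrow> 'u) set \<Rightarrow> ('x::polish_space, 'u) risk_family \<Rightarrow> bool" where
  "terminal_condition T P \<rho> \<longleftrightarrow> (\<forall>\<pi>\<in>P. \<forall>Z\<in>Ztup T T. \<forall>h\<in>space (hist T). \<rho> \<pi> T Z h = Z T h)"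

definition one_step_tup ::
    "nat \<Rightarrow> nat \<Rightarrow> ((nat \<Rightarrow> 'x) \<Rightarrow> real) \<Rightarrow> nat \<Rightarrow> (nat \<Rightarrow> 'x::polish_space) \<Rightarrow> real" where
  "one_step_tup T t V = (zero_tup T t)(Suc t := V)"

end

theory Submission
  imports Defs
begin

text \<open>
  The representing functional is forced. If \<open>\<rho>\<close> is translation-invariant and normalized, then
  \<open>\<rho>\<^bsub>t+1,T\<^esub>(V, 0, \<dots>, 0) = V\<close>, so every bounded measurable \<open>v\<close> occurs as the continuation
  risk \<open>x \<mapsto> \<rho>\<^bsub>t+1,T\<^esub>(\<dots>)(h, x)\<close> of some process, namely of \<open>(0, V, 0, \<dots>, 0)\<close> with
  \<open>V(h, x) = v(x)\<close> (\<open>next_section_one_step\<close>). Inserting this process into the recursion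
  leaves \<open>\<sigma>\<^sub>t(h, q, v) = \<rho>\<^sup>\<pi>\<^bsub>t,T\<^esub>(0, V, 0, \<dots>, 0)(h)\<close> as the only candidate, for any policy
  \<open>\<pi>\<close> with \<open>Q\<^sup>\<pi>\<^sub>t(h) = q\<close>; this is the uniqueness part.

  Conversely, take this formula as a definition, for some choice of \<open>\<pi>\<close>. Stochastic conditional
  time consistency says that, for a given \<open>Z\<^sub>t(h)\<close>, \<open>\<rho>\<^sup>\<pi>\<^bsub>t,T\<^esub>(Z)(h)\<close> depends on the policy and on the future
  \<open>(Z\<^bsub>t+1\<^esub>, \<dots>, Z\<^sub>T)\<close> only through the distribution of the continuation risk under
  \<open>Q\<^sup>\<pi>\<^sub>t(h)\<close>, and monotonically so. Hence the choice of \<open>\<pi>\<close> is immaterial, a general process with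
  \<open>Z\<^sub>t = 0\<close> may be replaced by the one-step process with the same continuation risk
  (which gives the recursion), and comparing one-step processes gives strong monotonicity.

  If some \<open>\<sigma>\<close> represents \<open>\<rho>\<close>, then translation invariance is visible in the recursion, because the
  continuation risk does not involve \<open>Z\<^sub>t\<close>; at the horizon, where there is no recursion, it is
  the terminal condition, which a normalized translation-invariant \<open>\<rho>\<^bsub>T,T\<^esub>\<close> satisfies
  in turn. Moreover, the hypothesis of time consistency is exactly the
  stochastic order that strong monotonicity of \<open>\<sigma>\<close> asks for.

  All of this rests on two measurability facts: continuation risks are bounded and measurable
  in the next state, and the measures \<open>Q\<^sup>\<pi>\<^sub>t(h)\<close> are Borel probability measures, since an
  admissible policy keeps the controlled history in the graph on which the kernels live.
\<close>

section \<open>Histories and their extensions\<close>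

lemma hist_append_measurable:
  assumes "h \<in> space (hist t)"
  shows "(\<lambda>x. h(Suc t := x)) \<in> borel \<rightarrow>\<^sub>M hist (Suc t)"
  unfolding hist_def
proof (rule measurable_fun_upd[where J = "{1..t}"])
  show "(\<lambda>x. h) \<in> borel \<rightarrow>\<^sub>M Pi\<^sub>M {1..t} (\<lambda>_. borel)"
    using assms by (simp add: hist_def)
qed auto

lemma hist_append_in_space:
  assumes "h \<in> space (hist t)"
  shows "h(Suc t := x) \<in> space (hist (Suc t))"
  using measurable_space[OF hist_append_measurable[OF assms]] by simp

lemma restrict_in_space_hist:
  assumes "h \<in> space (hist t)" "s \<le> t"
  shows "restrict h {1..s} \<in> space (hist s)"
  using assms by (auto simp: hist_def space_PiM)

definition last_state_rv :: "nat \<Rightarrow> ('x::polish_space \<Rightarrow> real) \<Rightarrow> (nat \<Rightarrow> 'x) \<Rightarrow> real" where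
  "last_state_rv t v = (\<lambda>g\<in>space (hist t). v (g t))"

lemma last_state_rv_in_Zsp:
  assumes v: "v \<in> bdd_fun" and "1 \<le> t"
  shows "last_state_rv t v \<in> Zsp t"
proof -
  have "(\<lambda>g. g t) \<in> hist t \<rightarrow>\<^sub>M borel"
    unfolding hist_def using \<open>1 \<le> t\<close> by (intro measurable_component_singleton) auto
  then have "(\<lambda>g. v (g t)) \<in> borel_measurable (hist t)"
    using v unfolding bdd_fun_def by (auto intro: measurable_compose)
  then have "last_state_rv t v \<in> borel_measurable (hist t)"
    by (subst measurable_cong[where g = "\<lambda>g. v (g t)"]) (auto simp: last_state_rv_def)
  moreover have "bounded (last_state_rv t v ` space (hist t))"
    using v unfolding bdd_fun_def by (auto intro: bounded_subset simp: last_state_rv_def)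
  ultimately show ?thesis
    by (simp add: Zsp_def last_state_rv_def)
qed

lemma last_state_rv_append:
  assumes "h \<in> space (hist t)"
  shows "last_state_rv (Suc t) v (h(Suc t := x)) = v x"
  using hist_append_in_space[OF assms] by (simp add: last_state_rv_def)

section \<open>One-step processes\<close>

lemma zero_rv_in_Zsp: "zero_rv t \<in> Zsp t"
proof -
  have "zero_rv t \<in> borel_measurable (hist t)"
    by (subst measurable_cong[where g = "\<lambda>_. 0"]) (auto simp: zero_rv_def)
  moreover have "bounded (zero_rv t ` space (hist t))"
    by (rule bounded_subset[of "{0}"]) (auto simp: zero_rv_def)
  ultimately show ?thesis
    unfolding Zsp_def zero_rv_def by auto
qed

lemma zero_tup_in_Ztup: "zero_tup T t \<in> Ztup T t"
  by (auto simp: zero_tup_def Ztup_def zero_rv_in_Zsp)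

lemma Ztup_update:
  assumes "Z \<in> Ztup T t" "s \<in> {t..T}" "V \<in> Zsp s"
  shows "Z(s := V) \<in> Ztup T t"
  using assms unfolding Ztup_def by (auto simp: PiE_iff extensional_def)

lemma Ztup_tail:
  assumes "Z \<in> Ztup T t"
  shows "restrict Z {Suc t..T} \<in> Ztup T (Suc t)"
  using assms unfolding Ztup_def by (auto simp: PiE_iff)

lemma one_step_tup_in_Ztup:
  assumes "t < T" "V \<in> Zsp (Suc t)"
  shows "one_step_tup T t V \<in> Ztup T t"
  unfolding one_step_tup_def using assms by (intro Ztup_update zero_tup_in_Ztup) auto

lemma one_step_tup_at:
  assumes "t < T" "h \<in> space (hist t)"
  shows "one_step_tup T t V t h = 0"
  using assms by (simp add: one_step_tup_def zero_tup_def zero_rv_def)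

lemma one_step_tup_zero:
  assumes "t < T"
  shows "one_step_tup T t (zero_rv (Suc t)) = zero_tup T t"
  using assms by (auto simp: one_step_tup_def zero_tup_def fun_eq_iff)

lemma one_step_tup_tail:
  assumes "t < T"
  shows "restrict (one_step_tup T t V) {Suc t..T} = (zero_tup T (Suc t))(Suc t := V)"
  using assms by (auto simp: one_step_tup_def zero_tup_def fun_eq_iff restrict_def)

lemma next_section_current_update:
  "next_section T \<rho> \<pi> t (Z(t := V)) = next_section T \<rho> \<pi> t Z"
proof -
  have "restrict (Z(t := V)) {Suc t..T} = restrict Z {Suc t..T}"
    by (auto simp: restrict_def)
  then show ?thesis
    by (simp add: next_section_def fun_eq_iff)
qed

section \<open>Stochastic order of image measures\<close>

text \<open>
  The measurable sets of \<open>q1\<close> and \<open>q2\<close> matter because image measures are formed by measurable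
  maps only. This turns the stochastic order of \<open>\<sigma>\<close> into the inequality of time consistency.
\<close>

lemma st_le_distr_iff:
  assumes "sets q1 = sets borel" "sets q2 = sets borel"
    and "v1 \<in> bdd_fun" "v2 \<in> bdd_fun"
  shows "distr q1 borel v1 \<preceq>\<^sub>s\<^sub>t distr q2 borel v2 \<longleftrightarrow>
    (\<forall>\<eta>. measure q1 {x. v1 x > \<eta>} \<le> measure q2 {x. v2 x > \<eta>})"
proof -
  have "measure (distr q borel v) {\<eta><..} = measure q {x. v x > \<eta>}"
    if "sets q = sets borel" "v \<in> bdd_fun" for q v and \<eta> :: real
  proof -
    have "v \<in> borel_measurable q"
      using that by (simp add: bdd_fun_def measurable_cong_sets[OF that(1) refl])
    moreover have "space q = UNIV"
      using sets_eq_imp_space_eq[OF that(1)] by simp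
    ultimately show ?thesis
      by (simp add: measure_distr vimage_def)
  qed
  from this[OF assms(1,3)] this[OF assms(2,4)] show ?thesis
    by (simp add: st_le_def)
qed

section \<open>Controlled histories of admissible policies\<close>

lemma traj_cong:
  assumes "\<And>r. r \<in> {1..s} \<Longrightarrow> h r = g r"
  shows "traj \<pi> s h = traj \<pi> s g"
proof -
  have eq: "restrict h {1..r} = restrict g {1..r}" if "r \<in> {1..s}" for r
    using assms that by (auto simp: restrict_def)
  show ?thesis
    unfolding traj_def by (intro restrict_ext) (simp only: eq assms)
qed

lemma traj_Suc:
  "traj \<pi> (Suc s) h = (traj \<pi> s h)(Suc s := (h (Suc s), \<pi> (Suc s) (restrict h {1..Suc s})))"
  by (auto simp: traj_def fun_eq_iff)

text \<open>
  Admissibility of \<open>\<pi>\<close> at time \<open>s\<close> speaks of histories of length \<open>s\<close>, so it is applied to the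
  initial segments of \<open>h\<close>; the controlled history up to \<open>s\<close> depends on nothing more.
\<close>

lemma traj_in_adm_graph:
  assumes \<pi>: "\<pi> \<in> policies T U A" and h: "h \<in> space (hist t)" and "t \<le> T"
  shows "s \<le> t \<Longrightarrow> traj \<pi> s h \<in> adm_graph A s"
proof (induction s)
  case 0
  then show ?case by (simp add: traj_def restrict_def)
next
  case (Suc s)
  let ?g = "restrict h {1..Suc s}"
  have "?g \<in> space (hist (Suc s))"
    using h Suc.prems by (rule restrict_in_space_hist)
  moreover have "Suc s \<in> {1..T}"
    using Suc.prems \<open>t \<le> T\<close> by simp
  ultimately have "\<pi> (Suc s) ?g \<in> A (Suc s) (traj \<pi> (Suc s - 1) ?g, ?g (Suc s))"
    using \<pi> unfolding policies_def by blast
  moreover have "traj \<pi> s ?g = traj \<pi> s h"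
    by (rule traj_cong) simp
  ultimately have "\<pi> (Suc s) ?g \<in> A (Suc s) (traj \<pi> s h, h (Suc s))"
    by simp
  moreover have "traj \<pi> s h \<in> adm_graph A s"
    using Suc by simp
  ultimately show ?case
    unfolding traj_Suc adm_graph.simps by blast
qed

lemma traj_in_ctrl_hist:
  assumes \<pi>: "\<pi> \<in> policies T U A" and h: "h \<in> space (hist t)" and "t \<le> T"
  shows "traj \<pi> t h \<in> space (ctrl_hist U t)"
proof -
  have "\<pi> s (restrict h {1..s}) \<in> U" if "s \<in> {1..t}" for s
  proof -
    have \<pi>s: "\<pi> s \<in> hist s \<rightarrow>\<^sub>M restrict_space borel U"
      using \<pi> that \<open>t \<le> T\<close> by (auto simp: policies_def)
    have "restrict h {1..s} \<in> space (hist s)"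
      using h that by (intro restrict_in_space_hist) auto
    from measurable_space[OF \<pi>s this] show ?thesis
      by (simp add: space_restrict_space)
  qed
  then show ?thesis
    by (auto simp: ctrl_hist_def traj_def space_PiM space_pair_measure space_restrict_space)
qed

lemma (in controlled_system) sets_Q_pol:
  assumes "\<pi> \<in> policies T U A" "t \<in> {1..<T}" "h \<in> space (hist t)"
  shows "sets (Q_pol Q \<pi> t h) = sets borel"
proof -
  have "traj \<pi> t h \<in> space (restrict_space (ctrl_hist U t) (adm_graph A t))"
    using assms traj_in_adm_graph[of \<pi> T U A h t t] traj_in_ctrl_hist[of \<pi> T U A h t]
    by (simp add: space_restrict_space)
  then have "Q_pol Q \<pi> t h \<in> space (prob_algebra borel)"
    using measurable_space[OF kernels[OF assms(2)]] by (simp add: Q_pol_def)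
  then show ?thesis
    by (simp add: space_prob_algebra)
qed

section \<open>Continuation risks\<close>

locale controlled_risk_family = controlled_system T U A Q
  for T :: nat
    and U :: "'u::polish_space set"
    and A :: "nat \<Rightarrow> (nat \<Rightarrow> 'x::polish_space \<times> 'u) \<times> 'x \<Rightarrow> 'u set"
    and Q :: "nat \<Rightarrow> (nat \<Rightarrow> 'x \<times> 'u) \<Rightarrow> 'x measure" +
  fixes \<rho> :: "('x, 'u) risk_family"
  assumes risk_family: "dynamic_risk_family T (policies T U A) \<rho>"
begin

abbreviation P :: "(nat \<Rightarrow> (nat \<Rightarrow> 'x) \<Rightarrow> 'u) set" where
  "P \<equiv> policies T U A"

lemma risk_in_Zsp:
  assumes "\<pi> \<in> P" "t \<in> {1..T}" "Z \<in> Ztup T t"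
  shows "\<rho> \<pi> t Z \<in> Zsp t"
  using risk_family assms unfolding dynamic_risk_family_def conditional_risk_measure_def by blast

lemma risk_zero:
  assumes "\<pi> \<in> P" "t \<in> {1..T}" "h \<in> space (hist t)"
  shows "\<rho> \<pi> t (zero_tup T t) h = 0"
  using risk_family assms
  unfolding dynamic_risk_family_def conditional_risk_measure_def zero_rv_def by auto

lemma next_section_in_bdd_fun:
  assumes "\<pi> \<in> P" "t \<in> {1..<T}" "Z \<in> Ztup T t" and h: "h \<in> space (hist t)"
  shows "next_section T \<rho> \<pi> t Z h \<in> bdd_fun"
proof -
  let ?R = "\<rho> \<pi> (Suc t) (restrict Z {Suc t..T})"
  have R: "?R \<in> Zsp (Suc t)"
    using assms by (intro risk_in_Zsp Ztup_tail) auto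
  have eq: "next_section T \<rho> \<pi> t Z h = (\<lambda>x. ?R (h(Suc t := x)))"
    by (simp add: next_section_def fun_eq_iff)
  have "(\<lambda>x. ?R (h(Suc t := x))) \<in> borel_measurable borel"
    using R by (intro measurable_compose[OF hist_append_measurable[OF h]])
      (simp only: Zsp_def mem_Collect_eq)
  moreover have "range (\<lambda>x. ?R (h(Suc t := x))) \<subseteq> ?R ` space (hist (Suc t))"
    using hist_append_in_space[OF h] by auto
  then have "bounded (range (\<lambda>x. ?R (h(Suc t := x))))"
    using R by (auto simp: Zsp_def intro: bounded_subset)
  ultimately show ?thesis
    by (simp add: bdd_fun_def eq)
qed

text \<open>
  Translation invariance at time \<open>t + 1\<close> extracts \<open>V\<close>, and normalization removes the zero process
  that is left. Thus every section of a \<open>V\<close> is a continuation risk, under every policy.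
\<close>

lemma next_section_one_step:
  assumes ti: "translation_invariant_family T P \<rho>"
    and \<pi>: "\<pi> \<in> P" and t: "t \<in> {1..<T}" and h: "h \<in> space (hist t)" and V: "V \<in> Zsp (Suc t)"
  shows "next_section T \<rho> \<pi> t (one_step_tup T t V) h = (\<lambda>x. V (h(Suc t := x)))"
proof
  fix x
  let ?g = "h(Suc t := x)" and ?Z = "(zero_tup T (Suc t))(Suc t := V)"
  have g: "?g \<in> space (hist (Suc t))"
    using h by (rule hist_append_in_space)
  have "?Z \<in> Ztup T (Suc t)"
    using t V by (intro Ztup_update zero_tup_in_Ztup) auto
  then have "\<rho> \<pi> (Suc t) ?Z ?g = V ?g + \<rho> \<pi> (Suc t) (?Z(Suc t := zero_rv (Suc t))) ?g"
    using ti \<pi> t g unfolding translation_invariant_family_def translation_invariant_def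
    by fastforce
  also have "?Z(Suc t := zero_rv (Suc t)) = zero_tup T (Suc t)"
    using t by (auto simp: zero_tup_def fun_eq_iff)
  finally show "next_section T \<rho> \<pi> t (one_step_tup T t V) h x = V ?g"
    using t \<pi> g by (simp add: next_section_def one_step_tup_tail risk_zero del: fun_upd_apply)
qed

section \<open>From a risk family to its transition functional\<close>

text \<open>
  The policy is chosen arbitrarily among those that generate \<open>q\<close> at \<open>h\<close>. The values at measures that no
  policy generates are meaningless.
\<close>

definition transition_functional :: "nat \<Rightarrow> (nat \<Rightarrow> 'x) \<Rightarrow> 'x measure \<Rightarrow> ('x \<Rightarrow> real) \<Rightarrow> real" where
  "transition_functional t h q v =
     \<rho> (SOME \<pi>. \<pi> \<in> P \<and> Q_pol Q \<pi> t h = q) t (one_step_tup T t (last_state_rv (Suc t) v)) h"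

lemma transition_functional_policy:
  assumes "q \<in> attainable P Q t h"
  obtains \<pi> where "\<pi> \<in> P" "Q_pol Q \<pi> t h = q"
    "\<And>v. transition_functional t h q v =
      \<rho> \<pi> t (one_step_tup T t (last_state_rv (Suc t) v)) h"
proof
  let ?\<pi> = "SOME \<pi>. \<pi> \<in> P \<and> Q_pol Q \<pi> t h = q"
  have "?\<pi> \<in> P \<and> Q_pol Q ?\<pi> t h = q"
    using assms by (intro someI_ex[of "\<lambda>\<pi>. \<pi> \<in> P \<and> Q_pol Q \<pi> t h = q"]) (auto simp: attainable_def)
  then show "?\<pi> \<in> P" "Q_pol Q ?\<pi> t h = q"
    by auto
qed (simp add: transition_functional_def)

lemma terminal_if_translation_invariant:
  assumes ti: "translation_invariant_family T P \<rho>"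
  shows "terminal_condition T P \<rho>"
  unfolding terminal_condition_def
proof (intro ballI)
  fix \<pi> and Z :: "nat \<Rightarrow> (nat \<Rightarrow> 'x) \<Rightarrow> real" and h :: "nat \<Rightarrow> 'x"
  assume "\<pi> \<in> P" and Z: "Z \<in> Ztup T T" and h: "h \<in> space (hist T)"
  have "Z(T := zero_rv T) = zero_tup T T"
    using Z by (auto simp: Ztup_def zero_tup_def PiE_iff extensional_def fun_eq_iff)
  moreover have "\<rho> \<pi> T Z h = Z T h + \<rho> \<pi> T (Z(T := zero_rv T)) h"
    using ti \<open>\<pi> \<in> P\<close> Z h horizon
    unfolding translation_invariant_family_def translation_invariant_def by simp
  ultimately show "\<rho> \<pi> T Z h = Z T h"
    using risk_zero[OF \<open>\<pi> \<in> P\<close> _ h] horizon by simp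
qed

lemma time_consistentD:
  assumes "stoch_cond_time_consistent T P Q \<rho>"
    and "\<pi> \<in> P" "\<pi>' \<in> P" "t \<in> {1..<T}" "h \<in> space (hist t)" "Z \<in> Ztup T t" "W \<in> Ztup T t"
    and "Z t h = W t h"
    and "\<And>\<eta>. measure (Q_pol Q \<pi> t h) {x. next_section T \<rho> \<pi> t Z h x > \<eta>}
            \<le> measure (Q_pol Q \<pi>' t h) {x. next_section T \<rho> \<pi>' t W h x > \<eta>}"
  shows "\<rho> \<pi> t Z h \<le> \<rho> \<pi>' t W h"
  using assms unfolding stoch_cond_time_consistent_def by blast

text \<open>
  The order in the definition of time consistency is reflexive, so time consistency applied
  in both directions turns equality of the data into equality of the risks.
\<close>

lemma time_consistent_eq:
  assumes tc: "stoch_cond_time_consistent T P Q \<rho>"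
    and "\<pi> \<in> P" "\<pi>' \<in> P" "t \<in> {1..<T}" "h \<in> space (hist t)" "Z \<in> Ztup T t" "W \<in> Ztup T t"
    and "Z t h = W t h"
    and "Q_pol Q \<pi> t h = Q_pol Q \<pi>' t h"
    and "next_section T \<rho> \<pi> t Z h = next_section T \<rho> \<pi>' t W h"
  shows "\<rho> \<pi> t Z h = \<rho> \<pi>' t W h"
  using assms by (intro antisym time_consistentD[OF tc]) simp_all

lemma represents_transition_functional:
  assumes ti: "translation_invariant_family T P \<rho>" and tc: "stoch_cond_time_consistent T P Q \<rho>"
  shows "represents T P Q \<rho> transition_functional"
proof -
  have lift: "one_step_tup T t (last_state_rv (Suc t) v) \<in> Ztup T t"
      "next_section T \<rho> \<pi> t (one_step_tup T t (last_state_rv (Suc t) v)) h = v"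
    if "\<pi> \<in> P" "t \<in> {1..<T}" "h \<in> space (hist t)" "v \<in> bdd_fun" for \<pi> t h v
  proof -
    have V: "last_state_rv (Suc t) v \<in> Zsp (Suc t)"
      using that by (intro last_state_rv_in_Zsp) auto
    then show "one_step_tup T t (last_state_rv (Suc t) v) \<in> Ztup T t"
      using that by (intro one_step_tup_in_Ztup) auto
    show "next_section T \<rho> \<pi> t (one_step_tup T t (last_state_rv (Suc t) v)) h = v"
      using next_section_one_step[OF ti that(1-3) V] last_state_rv_append[OF that(3)]
      by (simp add: fun_eq_iff)
  qed
  have "normalized_functional (attainable P Q t h) (transition_functional t h)"
    if t: "t \<in> {1..<T}" and h: "h \<in> space (hist t)" for t h
    unfolding normalized_functional_def
  proof
    fix q assume "q \<in> attainable P Q t h"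
    then obtain \<pi> where "\<pi> \<in> P" and \<sigma>: "\<And>v. transition_functional t h q v =
        \<rho> \<pi> t (one_step_tup T t (last_state_rv (Suc t) v)) h"
      by (rule transition_functional_policy) blast
    have "last_state_rv (Suc t) (\<lambda>_. 0) = (zero_rv (Suc t) :: (nat \<Rightarrow> 'x) \<Rightarrow> real)"
      by (simp add: last_state_rv_def zero_rv_def)
    then show "transition_functional t h q (\<lambda>_. 0) = 0"
      using \<sigma> risk_zero[OF \<open>\<pi> \<in> P\<close> _ h] t by (simp add: one_step_tup_zero)
  qed
  moreover have "strongly_monotone (attainable P Q t h) (transition_functional t h)"
    if t: "t \<in> {1..<T}" and h: "h \<in> space (hist t)" for t h
    unfolding strongly_monotone_def
  proof (intro ballI impI)
    fix q1 q2 and v1 v2 :: "'x \<Rightarrow> real"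
    assume q: "q1 \<in> attainable P Q t h" "q2 \<in> attainable P Q t h"
      and v: "v1 \<in> bdd_fun" "v2 \<in> bdd_fun"
      and le: "distr q1 borel v1 \<preceq>\<^sub>s\<^sub>t distr q2 borel v2"
    obtain \<pi>1 where \<pi>1: "\<pi>1 \<in> P" "Q_pol Q \<pi>1 t h = q1" "\<And>v. transition_functional t h q1 v =
        \<rho> \<pi>1 t (one_step_tup T t (last_state_rv (Suc t) v)) h"
      using q(1) by (rule transition_functional_policy) blast
    obtain \<pi>2 where \<pi>2: "\<pi>2 \<in> P" "Q_pol Q \<pi>2 t h = q2" "\<And>v. transition_functional t h q2 v =
        \<rho> \<pi>2 t (one_step_tup T t (last_state_rv (Suc t) v)) h"
      using q(2) by (rule transition_functional_policy) blast
    have "\<forall>\<eta>. measure q1 {x. v1 x > \<eta>} \<le> measure q2 {x. v2 x > \<eta>}"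
      using le st_le_distr_iff[OF _ _ v, of q1 q2]
        sets_Q_pol[OF \<pi>1(1) t h] sets_Q_pol[OF \<pi>2(1) t h] \<pi>1(2) \<pi>2(2) by simp
    then show "transition_functional t h q1 v1 \<le> transition_functional t h q2 v2"
      unfolding \<pi>1(3) \<pi>2(3)
      using \<pi>1(1,2) \<pi>2(1,2) t h v lift
      by (intro time_consistentD[OF tc]) (simp_all add: one_step_tup_at)
  qed
  moreover have "\<rho> \<pi> t Z h = Z t h + transition_functional t h (Q_pol Q \<pi> t h) (next_section T \<rho> \<pi> t Z h)"
    if \<pi>: "\<pi> \<in> P" and t: "t \<in> {1..<T}" and Z: "Z \<in> Ztup T t" and h: "h \<in> space (hist t)" for \<pi> t Z h
  proof -
    let ?v = "next_section T \<rho> \<pi> t Z h"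
    have "Q_pol Q \<pi> t h \<in> attainable P Q t h"
      using \<pi> by (simp add: attainable_def)
    then obtain \<pi>' where \<pi>': "\<pi>' \<in> P" "Q_pol Q \<pi>' t h = Q_pol Q \<pi> t h"
      "\<And>v. transition_functional t h (Q_pol Q \<pi> t h) v =
        \<rho> \<pi>' t (one_step_tup T t (last_state_rv (Suc t) v)) h"
      by (rule transition_functional_policy) blast
    have v: "?v \<in> bdd_fun"
      using \<pi> t Z h by (rule next_section_in_bdd_fun)
    have Z0: "Z(t := zero_rv t) \<in> Ztup T t"
      using Z t by (intro Ztup_update zero_rv_in_Zsp) auto
    \<comment> \<open>Both processes vanish at time \<open>t\<close> and have the continuation risk \<open>?v\<close>.\<close>
    have "\<rho> \<pi> t (Z(t := zero_rv t)) h = \<rho> \<pi>' t (one_step_tup T t (last_state_rv (Suc t) ?v)) h"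
      using \<pi> \<pi>'(1,2) t h Z0 v lift
      by (intro time_consistent_eq[OF tc])
        (simp_all add: one_step_tup_at next_section_current_update zero_rv_def)
    moreover have "\<rho> \<pi> t Z h = Z t h + \<rho> \<pi> t (Z(t := zero_rv t)) h"
      using ti \<pi> t Z h unfolding translation_invariant_family_def translation_invariant_def by simp
    ultimately show ?thesis
      by (simp add: \<pi>'(3))
  qed
  ultimately show ?thesis
    by (simp add: represents_def)
qed

section \<open>From a representation to the risk family\<close>

lemma represents_step:
  assumes "represents T P Q \<rho> \<sigma>"
    and "\<pi> \<in> P" "t \<in> {1..<T}" "Z \<in> Ztup T t" "h \<in> space (hist t)"
  shows "\<rho> \<pi> t Z h = Z t h + \<sigma> t h (Q_pol Q \<pi> t h) (next_section T \<rho> \<pi> t Z h)"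
  using assms by (simp add: represents_def)

lemma translation_invariant_if_represents:
  assumes tm: "terminal_condition T P \<rho>" and rep: "represents T P Q \<rho> \<sigma>"
  shows "translation_invariant_family T P \<rho>"
  unfolding translation_invariant_family_def translation_invariant_def
proof (intro ballI)
  fix \<pi> t and Z :: "nat \<Rightarrow> (nat \<Rightarrow> 'x) \<Rightarrow> real" and h :: "nat \<Rightarrow> 'x"
  assume \<pi>: "\<pi> \<in> P" and t: "t \<in> {1..T}" and Z: "Z \<in> Ztup T t" and h: "h \<in> space (hist t)"
  have Z0: "Z(t := zero_rv t) \<in> Ztup T t"
    using Z t by (intro Ztup_update zero_rv_in_Zsp) auto
  show "\<rho> \<pi> t Z h = Z t h + \<rho> \<pi> t (Z(t := zero_rv t)) h"
  proof (cases "t = T")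
    case True
    then show ?thesis
      using tm \<pi> Z Z0 h by (simp add: terminal_condition_def zero_rv_def)
  next
    case False
    then have "t \<in> {1..<T}"
      using t by simp
    then show ?thesis
      using represents_step[OF rep \<pi> _ Z h] represents_step[OF rep \<pi> _ Z0 h] h
      by (simp add: next_section_current_update zero_rv_def)
  qed
qed

lemma time_consistent_if_represents:
  assumes rep: "represents T P Q \<rho> \<sigma>"
  shows "stoch_cond_time_consistent T P Q \<rho>"
  unfolding stoch_cond_time_consistent_def
proof (intro ballI impI)
  fix \<pi> \<pi>' t h Z W
  assume \<pi>: "\<pi> \<in> P" "\<pi>' \<in> P" and t: "t \<in> {1..<T}" and h: "h \<in> space (hist t)"
    and Z: "Z \<in> Ztup T t" and W: "W \<in> Ztup T t" and eq: "Z t h = W t h"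
    and le: "\<forall>\<eta>. measure (Q_pol Q \<pi> t h) {x. next_section T \<rho> \<pi> t Z h x > \<eta>}
            \<le> measure (Q_pol Q \<pi>' t h) {x. next_section T \<rho> \<pi>' t W h x > \<eta>}"
  let ?v = "next_section T \<rho> \<pi> t Z h" and ?w = "next_section T \<rho> \<pi>' t W h"
  have v: "?v \<in> bdd_fun" and w: "?w \<in> bdd_fun"
    using \<pi> t Z W h by (auto intro: next_section_in_bdd_fun)
  have "distr (Q_pol Q \<pi> t h) borel ?v \<preceq>\<^sub>s\<^sub>t distr (Q_pol Q \<pi>' t h) borel ?w"
    using le st_le_distr_iff[OF sets_Q_pol[OF \<pi>(1) t h] sets_Q_pol[OF \<pi>(2) t h] v w] by simp
  moreover have "strongly_monotone (attainable P Q t h) (\<sigma> t h)"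
    using rep t h by (simp add: represents_def)
  moreover have "Q_pol Q \<pi> t h \<in> attainable P Q t h" "Q_pol Q \<pi>' t h \<in> attainable P Q t h"
    using \<pi> by (auto simp: attainable_def)
  ultimately have "\<sigma> t h (Q_pol Q \<pi> t h) ?v \<le> \<sigma> t h (Q_pol Q \<pi>' t h) ?w"
    using v w unfolding strongly_monotone_def by blast
  then show "\<rho> \<pi> t Z h \<le> \<rho> \<pi>' t W h"
    using represents_step[OF rep \<pi>(1) t Z h] represents_step[OF rep \<pi>(2) t W h] eq by simp
qed

section \<open>Uniqueness\<close>

text \<open>
  The recursion determines \<open>\<sigma>\<close> at continuation risks only. Translation invariance makes every
  bounded measurable function one of them, which is why no freedom is left.
\<close>

lemma represents_value:
  assumes ti: "translation_invariant_family T P \<rho>" and rep: "represents T P Q \<rho> \<sigma>"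
    and \<pi>: "\<pi> \<in> P" and t: "t \<in> {1..<T}" and h: "h \<in> space (hist t)" and V: "V \<in> Zsp (Suc t)"
  shows "\<sigma> t h (Q_pol Q \<pi> t h) (\<lambda>x. V (h(Suc t := x))) = \<rho> \<pi> t (one_step_tup T t V) h"
  using represents_step[OF rep \<pi> t one_step_tup_in_Ztup[OF _ V] h] t h
  by (simp add: next_section_one_step[OF ti \<pi> t h V] one_step_tup_at)

lemma represents_unique:
  assumes ti: "translation_invariant_family T P \<rho>"
    and rep: "represents T P Q \<rho> \<sigma>" "represents T P Q \<rho> \<sigma>'"
    and t: "t \<in> {1..<T}" and h: "h \<in> space (hist t)"
    and q: "q \<in> attainable P Q t h" and v: "v \<in> bdd_fun"
  shows "\<sigma> t h q v = \<sigma>' t h q v"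
proof -
  obtain \<pi> where \<pi>: "\<pi> \<in> P" "q = Q_pol Q \<pi> t h"
    using q by (auto simp: attainable_def)
  have V: "last_state_rv (Suc t) v \<in> Zsp (Suc t)"
    using v by (intro last_state_rv_in_Zsp) auto
  show ?thesis
    using represents_value[OF ti rep(1) \<pi>(1) t h V] represents_value[OF ti rep(2) \<pi>(1) t h V]
    by (simp add: last_state_rv_append[OF h] \<pi>(2))
qed

end

theorem theorem3p3:
  fixes T :: nat
    and U :: "'u::polish_space set"
    and A :: "nat \<Rightarrow> (nat \<Rightarrow> 'x::polish_space \<times> 'u) \<times> 'x \<Rightarrow> 'u set"
    and Q :: "nat \<Rightarrow> (nat \<Rightarrow> 'x \<times> 'u) \<Rightarrow> 'x measure"
    and P :: "(nat \<Rightarrow> (nat \<Rightarrow> 'x) \<Rightarrow> 'u) set"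
    and \<rho> :: "('x, 'u) risk_family"
  assumes system: "controlled_system T U A Q"
    and P_def: "P = policies T U A"
    and family: "dynamic_risk_family T P \<rho>"
  shows "(translation_invariant_family T P \<rho> \<and> stoch_cond_time_consistent T P Q \<rho> \<longleftrightarrow>
            terminal_condition T P \<rho> \<and> (\<exists>\<sigma>. represents T P Q \<rho> \<sigma>)) \<and>
         (translation_invariant_family T P \<rho> \<and> stoch_cond_time_consistent T P Q \<rho> \<longrightarrow>
            (\<forall>\<sigma>. represents T P Q \<rho> \<sigma> \<longrightarrow>
              (\<forall>t\<in>{1..<T}. \<forall>h\<in>space (hist t). \<forall>q\<in>attainable P Q t h. \<forall>v\<in>bdd_fun.
                 (\<forall>\<pi>\<in>P. \<forall>V\<in>Zsp (Suc t).
                    q = Q_pol Q \<pi> t h \<longrightarrow> (\<forall>x. V (h(Suc t := x)) = v x) \<longrightarrow>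
                    \<sigma> t h q v = \<rho> \<pi> t (one_step_tup T t V) h) \<and>
                 (\<forall>\<sigma>'. represents T P Q \<rho> \<sigma>' \<longrightarrow> \<sigma> t h q v = \<sigma>' t h q v))))"
proof -
  interpret controlled_risk_family T U A Q \<rho>
    using system family P_def
    by (simp add: controlled_risk_family_def controlled_risk_family_axioms_def)
  have equivalence: "translation_invariant_family T P \<rho> \<and> stoch_cond_time_consistent T P Q \<rho> \<longleftrightarrow>
      terminal_condition T P \<rho> \<and> (\<exists>\<sigma>. represents T P Q \<rho> \<sigma>)"
    unfolding P_def
    by (meson terminal_if_translation_invariant represents_transition_functional
        translation_invariant_if_represents time_consistent_if_represents)
  show ?thesis
  proof (rule conjI[OF equivalence], intro impI allI ballI conjI)
    fix \<sigma> t h q v \<pi> V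
    assume "translation_invariant_family T P \<rho> \<and> stoch_cond_time_consistent T P Q \<rho>"
      "represents T P Q \<rho> \<sigma>" "t \<in> {1..<T}" "h \<in> space (hist t)"
      "\<pi> \<in> P" "V \<in> Zsp (Suc t)" "q = Q_pol Q \<pi> t h" "\<forall>x. V (h(Suc t := x)) = v x"
    then show "\<sigma> t h q v = \<rho> \<pi> t (one_step_tup T t V) h"
      using represents_value[of \<sigma> \<pi> t h V] P_def by simp
  next
    fix \<sigma> t h q \<sigma>' and v :: "'x \<Rightarrow> real"
    assume "translation_invariant_family T P \<rho> \<and> stoch_cond_time_consistent T P Q \<rho>"
      "represents T P Q \<rho> \<sigma>" "t \<in> {1..<T}" "h \<in> space (hist t)"
      "q \<in> attainable P Q t h" "v \<in> bdd_fun" "represents T P Q \<rho> \<sigma>'"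
    then show "\<sigma> t h q v = \<sigma>' t h q v"
      using represents_unique P_def by blast
  qed
qed

end
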